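(* For some $a>0$, let $g\colon(0,a)\to\mathbb R$ be a convex or concave function such that there exists a finite limit $\lim_{x\downarrow0}g(x)$. Then, for any $u\in(0,a)$, $$\int_{(0,u]}x\,|g''|(dx)<\infty.$$
   Context: $g''(dx)$ is the locally finite signed measure on $(0,a)$ satisfying $g''((x,y])=g'_+(y)-g'_+(x)$, $0<x<y<a$, where $g'_+$ is the right derivative, and $|g''|(dx)$ is its variation measure. *)

theory Defs
  imports "HOL-Analysis.Analysis"
begin

text \<open>
  A locally finite signed measure on \<open>S\<close> cannot in general be defined on \<open>S\<close> itself, as there may
  be infinite mass of both signs near the boundary of \<open>S\<close>.  It is a real-valued,
  countably additive function on the Borel sets that are contained in a compact subset of \<open>S\<close>.
\<close>

definition rel_compact_borel :: "real set \<Rightarrow> real set set" where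
  "rel_compact_borel S = {B \<in> sets borel. \<exists>K. compact K \<and> K \<subseteq> S \<and> B \<subseteq> K}"

text \<open>
  The second clause only fixes the irrelevant values of the total function \<open>\<mu>\<close> outside its
  proper domain, so that a signed measure is determined by its values on that domain.
\<close>

definition locally_finite_signed_measure :: "real set \<Rightarrow> (real set \<Rightarrow> real) \<Rightarrow> bool" where
  "locally_finite_signed_measure S \<mu> \<longleftrightarrow>
     (\<forall>A :: nat \<Rightarrow> real set.
        range A \<subseteq> rel_compact_borel S \<longrightarrow> disjoint_family A \<longrightarrow>
        (\<Union>i. A i) \<in> rel_compact_borel S \<longrightarrow>
        (\<lambda>i. \<mu> (A i)) sums \<mu> (\<Union>i. A i)) \<and>
     (\<forall>B. B \<notin> rel_compact_borel S \<longrightarrow> \<mu> B = 0)"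

text \<open>
  Total variation: supremum over countable partitions of \<open>B\<close> into sets on which \<open>\<mu>\<close> is defined.
\<close>

definition variation :: "real set \<Rightarrow> (real set \<Rightarrow> real) \<Rightarrow> real set \<Rightarrow> ennreal" where
  "variation S \<mu> B =
     (SUP C \<in> {C :: nat \<Rightarrow> real set.
                 disjoint_family C \<and> range C \<subseteq> rel_compact_borel S \<and> (\<Union>i. C i) = B}.
        \<Sum>i. ennreal \<bar>\<mu> (C i)\<bar>)"

definition variation_measure :: "real set \<Rightarrow> (real set \<Rightarrow> real) \<Rightarrow> real measure" where
  "variation_measure S \<mu> = measure_of S {B \<in> sets borel. B \<subseteq> S} (variation S \<mu>)"

definition right_deriv :: "(real \<Rightarrow> real) \<Rightarrow> real \<Rightarrow> real" where
  "right_deriv g x = vector_derivative g (at_right x)"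

definition is_second_deriv_measure ::
    "real \<Rightarrow> (real \<Rightarrow> real) \<Rightarrow> (real set \<Rightarrow> real) \<Rightarrow> bool" where
  "is_second_deriv_measure a g \<mu> \<longleftrightarrow>
     locally_finite_signed_measure {0<..<a} \<mu> \<and>
     (\<forall>x y. 0 < x \<longrightarrow> x < y \<longrightarrow> y < a \<longrightarrow> \<mu> {x<..y} = right_deriv g y - right_deriv g x)"

text \<open>
  \<open>g''\<close> on \<open>(0, a)\<close>.  For convex or concave \<open>g\<close> such a signed measure exists (\<open>g'\<^sub>+\<close> is monotone
  and right-continuous) and is unique.
\<close>

definition second_deriv_measure :: "real \<Rightarrow> (real \<Rightarrow> real) \<Rightarrow> real set \<Rightarrow> real" where
  "second_deriv_measure a g = (THE \<mu>. is_second_deriv_measure a g \<mu>)"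

text \<open>
  \<^const>\<open>measure_of\<close> yields the zero measure when its argument is not countably additive.  The
  rest of this theory shows that this does not happen for \<^const>\<open>variation_measure\<close>.
\<close>

lemma rel_compact_borel_subset:
  assumes "B \<in> rel_compact_borel S" "A \<in> sets borel" "A \<subseteq> B"
  shows "A \<in> rel_compact_borel S"
  using assms unfolding rel_compact_borel_def by blast

lemma rel_compact_borel_Int:
  assumes "B \<in> rel_compact_borel S" "A \<in> sets borel"
  shows "B \<inter> A \<in> rel_compact_borel S"
  using assms by (intro rel_compact_borel_subset[OF assms(1)]) (auto simp: rel_compact_borel_def)

lemma empty_in_rel_compact_borel: "{} \<in> rel_compact_borel S"
  unfolding rel_compact_borel_def by auto

lemma locally_finite_signed_measure_empty:
  assumes "locally_finite_signed_measure S \<mu>"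
  shows "\<mu> {} = 0"
proof -
  have "(\<lambda>i::nat. \<mu> {}) sums \<mu> {}"
    using assms empty_in_rel_compact_borel[of S]
    unfolding locally_finite_signed_measure_def
    by (auto dest!: spec[of _ "\<lambda>_. {}"] simp: disjoint_family_on_def)
  then show ?thesis
    using summable_const_iff sums_summable by blast
qed

lemma rel_compact_partition_exists:
  assumes "open S" "B \<in> sets borel" "B \<subseteq> S"
  shows "\<exists>C :: nat \<Rightarrow> real set.
           disjoint_family C \<and> range C \<subseteq> rel_compact_borel S \<and> (\<Union>i. C i) = B"
proof -
  obtain K :: "nat \<Rightarrow> real set" where K: "\<And>n. compact (K n)" "\<And>n. K n \<subseteq> S" "\<Union>(range K) = S"
    using open_Union_compact_subsets[OF assms(1)] by metis
  define D where "D = disjointed (\<lambda>n. B \<inter> K n)"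
  have m: "range (\<lambda>n. B \<inter> K n) \<subseteq> sets borel"
    using assms(2) K(1) by (auto intro: borel_compact)
  have "range D \<subseteq> sets borel"
    unfolding D_def using sets.range_disjointed_sets[OF m] .
  moreover have "D n \<subseteq> K n" for n
    using disjointed_subset[of "\<lambda>n. B \<inter> K n" n] unfolding D_def by auto
  ultimately have "D n \<in> rel_compact_borel S" for n
    using K(1)[of n] K(2)[of n] unfolding rel_compact_borel_def by auto
  then have "range D \<subseteq> rel_compact_borel S"
    by auto
  moreover have "disjoint_family D"
    unfolding D_def by (rule disjoint_family_disjointed)
  moreover have "(\<Union>i. D i) = B"
    unfolding D_def UN_disjointed_eq using K(3) assms(3) by blast
  ultimately show ?thesis by blast
qed

lemma suminf_swap_ennreal:
  fixes f :: "nat \<Rightarrow> nat \<Rightarrow> ennreal"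
  shows "(\<Sum>i. \<Sum>j. f i j) = (\<Sum>j. \<Sum>i. f i j)"
  using nn_integral_count_space_nn_integral[of "UNIV :: nat set" f "count_space (UNIV :: nat set)"]
  by (simp add: nn_integral_count_space_nat)

lemma variation_superadditive:
  assumes S: "open S"
    and A: "A \<in> sets borel" "A \<subseteq> S" and B: "B \<in> sets borel" "B \<subseteq> S" and "A \<inter> B = {}"
  shows "variation S \<mu> A + variation S \<mu> B \<le> variation S \<mu> (A \<union> B)"
proof -
  define P where "P X = {C :: nat \<Rightarrow> real set.
    disjoint_family C \<and> range C \<subseteq> rel_compact_borel S \<and> (\<Union>i. C i) = X}" for X
  define s where "s C = (\<Sum>i. ennreal \<bar>\<mu> (C i)\<bar>)" for C :: "nat \<Rightarrow> real set"
  have V: "variation S \<mu> X = (SUP C\<in>P X. s C)" for X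
    unfolding variation_def P_def s_def ..
  have ne: "P A \<noteq> {}" "P B \<noteq> {}"
    using rel_compact_partition_exists[OF S A] rel_compact_partition_exists[OF S B]
    unfolding P_def by auto
  have main: "s C + s D \<le> variation S \<mu> (A \<union> B)" if C: "C \<in> P A" and D: "D \<in> P B" for C D
  proof -
    define E where "E n = (if even n then C (n div 2) else D (n div 2))" for n
    have CD: "C i \<inter> D j = {}" for i j
      using C D \<open>A \<inter> B = {}\<close> unfolding P_def by blast
    have CC: "C i \<inter> C j = {}" "D i \<inter> D j = {}" if "i \<noteq> j" for i j
      using C D that unfolding P_def disjoint_family_on_def by auto
    have "disjoint_family E"
      unfolding disjoint_family_on_def
    proof (intro ballI impI)
      fix m n :: nat assume "m \<noteq> n"
      then have "m div 2 \<noteq> n div 2 \<or> even m \<noteq> even n"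
        by presburger
      then show "E m \<inter> E n = {}"
        unfolding E_def using CD CC[of "m div 2" "n div 2"] by (auto simp: Int_commute)
    qed
    moreover have "range E \<subseteq> rel_compact_borel S"
      using C D unfolding P_def E_def by auto
    moreover have "(\<Union>i. E i) = A \<union> B"
    proof -
      have "C i = E (2 * i)" "D i = E (2 * i + 1)" for i
        unfolding E_def by auto
      then have "(\<Union>i. C i) \<union> (\<Union>i. D i) \<subseteq> (\<Union>i. E i)" by blast
      moreover have "(\<Union>i. E i) \<subseteq> (\<Union>i. C i) \<union> (\<Union>i. D i)"
        unfolding E_def by auto
      ultimately show ?thesis using C D unfolding P_def by auto
    qed
    ultimately have "E \<in> P (A \<union> B)"
      unfolding P_def by auto
    then have "s E \<le> variation S \<mu> (A \<union> B)"
      unfolding V by (rule SUP_upper)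
    moreover have "s C + s D \<le> s E"
    proof -
      have fin: "(\<Sum>i<n. ennreal \<bar>\<mu> (C i)\<bar> + ennreal \<bar>\<mu> (D i)\<bar>) =
          (\<Sum>i<2 * n. ennreal \<bar>\<mu> (E i)\<bar>)" for n
        by (induction n) (auto simp: E_def add_ac)
      have "s C + s D = (\<Sum>i. ennreal \<bar>\<mu> (C i)\<bar> + ennreal \<bar>\<mu> (D i)\<bar>)"
        unfolding s_def by (intro suminf_add) auto
      also have "\<dots> \<le> s E"
        unfolding s_def by (intro suminf_le_const summableI, subst fin, intro sum_le_suminf) auto
      finally show ?thesis .
    qed
    ultimately show ?thesis by simp
  qed
  have "variation S \<mu> A + variation S \<mu> B = (SUP C\<in>P A. s C + variation S \<mu> B)"
    unfolding V[of A] by (rule ennreal_SUP_add_left[OF ne(1), symmetric])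
  also have "\<dots> = (SUP C\<in>P A. SUP D\<in>P B. s C + s D)"
    unfolding V[of B] by (simp add: ennreal_SUP_add_right[OF ne(2)])
  also have "\<dots> \<le> variation S \<mu> (A \<union> B)"
    by (intro SUP_least main)
  finally show ?thesis .
qed

lemma variation_countable_subadditive:
  assumes \<mu>: "locally_finite_signed_measure S \<mu>"
    and A: "range A \<subseteq> sets borel" "disjoint_family A"
  shows "variation S \<mu> (\<Union>i. A i) \<le> (\<Sum>i. variation S \<mu> (A i))"
  unfolding variation_def[of S \<mu> "\<Union>i. A i"]
proof (rule SUP_least, clarify)
  fix C :: "nat \<Rightarrow> real set"
  assume C: "disjoint_family C" "range C \<subseteq> rel_compact_borel S"
    and U: "\<Union>(range C) = (\<Union>i. A i)"
  have CA: "C j \<inter> A i \<in> rel_compact_borel S" for i j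
    using A(1) C(2) by (intro rel_compact_borel_Int) auto
  have "ennreal \<bar>\<mu> (C j)\<bar> \<le> (\<Sum>i. ennreal \<bar>\<mu> (C j \<inter> A i)\<bar>)" for j
  proof (cases "(\<Sum>i. ennreal \<bar>\<mu> (C j \<inter> A i)\<bar>) = top")
    case False
    have eq: "(\<Union>i. C j \<inter> A i) = C j" using U by blast
    have "range (\<lambda>i. C j \<inter> A i) \<subseteq> rel_compact_borel S"
      using CA by auto
    moreover have "disjoint_family (\<lambda>i. C j \<inter> A i)"
      using A(2) unfolding disjoint_family_on_def by blast
    moreover have "(\<Union>i. C j \<inter> A i) \<in> rel_compact_borel S"
      unfolding eq using C(2) by auto
    ultimately have sums: "(\<lambda>i. \<mu> (C j \<inter> A i)) sums \<mu> (C j)"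
      using \<mu> eq unfolding locally_finite_signed_measure_def by metis
    have sm: "summable (\<lambda>i. \<bar>\<mu> (C j \<inter> A i)\<bar>)"
      using False by (intro summable_suminf_not_top) auto
    have "\<bar>\<mu> (C j)\<bar> \<le> (\<Sum>i. \<bar>\<mu> (C j \<inter> A i)\<bar>)"
      using summable_rabs[OF sm] sums_unique[OF sums] by simp
    then have "ennreal \<bar>\<mu> (C j)\<bar> \<le> ennreal (\<Sum>i. \<bar>\<mu> (C j \<inter> A i)\<bar>)"
      by (rule ennreal_leI)
    also have "\<dots> = (\<Sum>i. ennreal \<bar>\<mu> (C j \<inter> A i)\<bar>)"
      by (rule suminf_ennreal2[OF abs_ge_zero sm, symmetric])
    finally show ?thesis .
  qed simp
  then have "(\<Sum>j. ennreal \<bar>\<mu> (C j)\<bar>) \<le> (\<Sum>j. \<Sum>i. ennreal \<bar>\<mu> (C j \<inter> A i)\<bar>)"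
    by (intro suminf_le allI summableI)
  also have "\<dots> = (\<Sum>i. \<Sum>j. ennreal \<bar>\<mu> (C j \<inter> A i)\<bar>)"
    by (rule suminf_swap_ennreal)
  also have "\<dots> \<le> (\<Sum>i. variation S \<mu> (A i))"
  proof (intro suminf_le allI summableI)
    fix i
    have "disjoint_family (\<lambda>j. C j \<inter> A i)"
      using C(1) unfolding disjoint_family_on_def by blast
    moreover have "(\<Union>j. C j \<inter> A i) = A i" using U by blast
    ultimately show "(\<Sum>j. ennreal \<bar>\<mu> (C j \<inter> A i)\<bar>) \<le> variation S \<mu> (A i)"
      unfolding variation_def using CA
      by (intro SUP_upper2[where i = "\<lambda>j. C j \<inter> A i"]) auto
  qed
  finally show "(\<Sum>j. ennreal \<bar>\<mu> (C j)\<bar>) \<le> (\<Sum>i. variation S \<mu> (A i))" .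
qed

lemma sigma_algebra_borel_subsets:
  assumes "open S"
  shows "sigma_algebra S {B \<in> sets borel. B \<subseteq> (S :: real set)}"
proof -
  have "{B \<in> sets borel. B \<subseteq> S} = sets (restrict_space borel S)"
    using sets_restrict_space_iff[of S borel] borel_open[OF assms] by auto
  moreover have "space (restrict_space borel S) = S"
    by (simp add: space_restrict_space)
  ultimately show ?thesis
    using sets.sigma_algebra_axioms[of "restrict_space borel S"] by simp
qed

lemma measure_space_variation:
  assumes S: "open S" and \<mu>: "locally_finite_signed_measure S \<mu>"
  shows "measure_space S {B \<in> sets borel. B \<subseteq> S} (variation S \<mu>)"
  unfolding measure_space_def
proof (intro conjI sigma_algebra_borel_subsets[OF S])
  have "(\<Sum>i. ennreal \<bar>\<mu> (C i)\<bar>) = 0" if "(\<Union>i. C i) = {}" for C :: "nat \<Rightarrow> real set"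
  proof -
    have "C i = {}" for i using that by blast
    then show ?thesis using locally_finite_signed_measure_empty[OF \<mu>] by simp
  qed
  then have "variation S \<mu> {} \<le> 0"
    unfolding variation_def by (intro SUP_least) (simp only: mem_Collect_eq order_refl)
  then have "variation S \<mu> {} = 0" by simp
  then show pos: "positive {B \<in> sets borel. B \<subseteq> S} (variation S \<mu>)"
    unfolding positive_def .
  show "countably_additive {B \<in> sets borel. B \<subseteq> S} (variation S \<mu>)"
  proof (rule countably_additiveI)
    fix A :: "nat \<Rightarrow> real set"
    assume A: "range A \<subseteq> {B \<in> sets borel. B \<subseteq> S}" "disjoint_family A"
    have meas: "A i \<in> sets borel" "A i \<subseteq> S" for i using A(1) by auto
    have fin: "(\<Sum>i<n. variation S \<mu> (A i)) \<le> variation S \<mu> (\<Union>i<n. A i)" for n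
    proof (induction n)
      case (Suc n)
      have "(\<Sum>i<Suc n. variation S \<mu> (A i)) \<le> variation S \<mu> (\<Union>i<n. A i) + variation S \<mu> (A n)"
        using Suc by (auto intro: add_mono)
      also have "\<dots> \<le> variation S \<mu> ((\<Union>i<n. A i) \<union> A n)"
      proof (rule variation_superadditive[OF S])
        have "A i \<inter> A n = {}" if "i < n" for i
          using A(2) that by (intro disjoint_family_onD[of A UNIV]) auto
        then show "(\<Union>i<n. A i) \<inter> A n = {}" by blast
      qed (use meas in auto)
      also have "(\<Union>i<n. A i) \<union> A n = (\<Union>i<Suc n. A i)"
        by (auto simp: less_Suc_eq)
      finally show ?case .
    qed simp
    have le: "(\<Sum>i<n. variation S \<mu> (A i)) \<le> variation S \<mu> (\<Union>i. A i)" for n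
    proof -
      have "(\<Union>i. A i) - (\<Union>i<n. A i) \<in> sets borel"
        using meas(1) by (intro sets.Diff sets.countable_UN sets.finite_UN) auto
      moreover have "(\<Union>i<n. A i) \<in> sets borel"
        using meas(1) by (intro sets.finite_UN) auto
      ultimately have "variation S \<mu> (\<Union>i<n. A i) + variation S \<mu> ((\<Union>i. A i) - (\<Union>i<n. A i))
          \<le> variation S \<mu> ((\<Union>i<n. A i) \<union> ((\<Union>i. A i) - (\<Union>i<n. A i)))"
        using meas(2) by (intro variation_superadditive[OF S]) auto
      also have "(\<Union>i<n. A i) \<union> ((\<Union>i. A i) - (\<Union>i<n. A i)) = (\<Union>i. A i)" by blast
      finally have "variation S \<mu> (\<Union>i<n. A i) \<le> variation S \<mu> (\<Union>i. A i)"
        by (rule order_trans[rotated]) simp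
      with fin[of n] show ?thesis by (rule order_trans)
    qed
    show "(\<Sum>i. variation S \<mu> (A i)) = variation S \<mu> (\<Union>i. A i)"
    proof (rule antisym)
      show "(\<Sum>i. variation S \<mu> (A i)) \<le> variation S \<mu> (\<Union>i. A i)"
        by (intro suminf_le_const le) simp
      show "variation S \<mu> (\<Union>i. A i) \<le> (\<Sum>i. variation S \<mu> (A i))"
        using meas A(2) by (intro variation_countable_subadditive[OF \<mu>]) auto
    qed
  qed
qed

lemma sets_variation_measure:
  assumes "open S"
  shows "sets (variation_measure S \<mu>) = {B \<in> sets borel. B \<subseteq> S}"
  unfolding variation_measure_def
  using sigma_algebra.sets_measure_of_eq[OF sigma_algebra_borel_subsets[OF assms]] by simp

lemma emeasure_variation_measure:
  assumes S: "open S" and \<mu>: "locally_finite_signed_measure S \<mu>"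
    and B: "B \<in> sets borel" "B \<subseteq> S"
  shows "emeasure (variation_measure S \<mu>) B = variation S \<mu> B"
  unfolding variation_measure_def
  using measure_space_variation[OF S \<mu>] B
  by (intro emeasure_measure_of_sigma) (auto simp: measure_space_def)

end

theory Submission
  imports Defs
begin

text \<open>
  The function \<open>\<mu> = g''\<close> has constant sign, so that its variation over \<open>(x, y]\<close> is
  \<open>\<bar>g'\<^sub>+(y) - g'\<^sub>+(x)\<bar>\<close>.  For convex \<open>g\<close> and \<open>x\<^sub>n = u / 2\<^sup>n\<close> the integral
  is at most \<open>\<Sum>\<^sub>n x\<^sub>n (g'\<^sub>+(x\<^sub>n) - g'\<^sub>+(x\<^sub>n\<^sub>+\<^sub>1))\<close>.  Summation by parts turns this into a sum of the terms
  \<open>- x\<^sub>n g'\<^sub>+(x\<^sub>n) \<le> - 2 (g(x\<^sub>n) - g(x\<^sub>n\<^sub>+\<^sub>1))\<close>, which telescopes and is bounded because \<open>g\<close> is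
  bounded near \<open>0\<close>.
\<close>

section \<open>The right derivative of a convex function\<close>

lemma convex_on_slopes:
  fixes g :: "real \<Rightarrow> real"
  assumes "convex_on I g" "x \<in> I" "z \<in> I" "x < y" "y < z"
  shows "(g y - g x) / (y - x) \<le> (g z - g x) / (z - x)"
    and "(g z - g x) / (z - x) \<le> (g z - g y) / (z - y)"
proof -
  have flip: "(g p - g q) / (p - q) = (g q - g p) / (q - p)" for p q
    by (metis minus_diff_eq minus_divide_divide)
  show "(g y - g x) / (y - x) \<le> (g z - g x) / (z - x)"
    using convex_on_slope_le(1)[OF assms] flip[of x y] flip[of x z] by simp
  show "(g z - g x) / (z - x) \<le> (g z - g y) / (z - y)"
    using convex_on_slope_le(2)[OF assms] flip[of x z] flip[of y z] by simp
qed

text \<open>Difference quotients at \<open>x\<close> increase with \<open>y\<close>, so their limit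
  from the right is their infimum. The real-valued \<open>INF\<close> has its intended meaning only
  for a set bounded below, hence the third conclusion.\<close>

lemma convex_on_has_right_deriv:
  fixes g :: "real \<Rightarrow> real"
  assumes g: "convex_on {l<..<r} g" and x: "l < x" "x < r"
  shows "(g has_vector_derivative right_deriv g x) (at_right x)"
    and "right_deriv g x = (INF y\<in>{x<..<r}. (g y - g x) / (y - x))"
    and "bdd_below ((\<lambda>y. (g y - g x) / (y - x)) ` {x<..<r})"
proof -
  define q where "q y = (g y - g x) / (y - x)" for y
  define D where "D = (INF y\<in>{x<..<r}. q y)"
  \<comment> \<open>Since the interval is open, there is room to the left of \<open>x\<close>; the
    slope of the chord from \<open>w\<close> to \<open>x\<close> bounds all quotients from
    below.\<close>
  obtain w where w: "l < w" "w < x"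
    using dense x(1) by blast
  have bdd: "bdd_below (q ` {x<..<r})"
  proof (rule bdd_belowI2)
    fix y assume y: "y \<in> {x<..<r}"
    then show "(g x - g w) / (x - w) \<le> q y"
      unfolding q_def using convex_on_slopes[OF g, of w y x] w x by auto
  qed
  then show "bdd_below ((\<lambda>y. (g y - g x) / (y - x)) ` {x<..<r})"
    by (simp add: q_def)
  have ne: "{x<..<r} \<noteq> {}"
    using x by simp
  have "(q \<longlongrightarrow> D) (at_right x)"
  proof (rule order_tendstoI)
    fix c assume "c < D"
    have "c < q y" if "y \<in> {x<..<r}" for y
      using cINF_lower[OF bdd that] \<open>c < D\<close> unfolding D_def by simp
    then show "\<forall>\<^sub>F y in at_right x. c < q y"
      using x by (auto simp: eventually_at_right[of x r])
  next
    fix c assume "D < c"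
    then obtain z where z: "z \<in> {x<..<r}" "q z < c"
      unfolding D_def using cINF_less_iff[OF ne bdd] by blast
    \<comment> \<open>By monotonicity of \<open>q\<close>, a single value below \<open>c\<close>
      forces all earlier ones below \<open>c\<close>.\<close>
    have "q y < c" if "x < y" "y < z" for y
      using convex_on_slopes(1)[OF g, of x z y] that x z unfolding q_def by auto
    then show "\<forall>\<^sub>F y in at_right x. q y < c"
      using z by (auto simp: eventually_at_right[of x z])
  qed
  then have deriv: "(g has_vector_derivative D) (at_right x)"
    unfolding has_real_derivative_iff_has_vector_derivative[symmetric] has_field_derivative_iff q_def .
  moreover have "right_deriv g x = D"
    unfolding right_deriv_def by (rule vector_derivative_within[OF _ deriv]) simp
  ultimately show "(g has_vector_derivative right_deriv g x) (at_right x)"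
    and "right_deriv g x = (INF y\<in>{x<..<r}. (g y - g x) / (y - x))"
    by (simp_all add: D_def q_def)
qed

lemma convex_on_right_deriv_le_slope:
  fixes g :: "real \<Rightarrow> real"
  assumes "convex_on {l<..<r} g" "l < x" "x < y" "y < r"
  shows "right_deriv g x \<le> (g y - g x) / (y - x)"
proof -
  have x: "x < r"
    using assms by simp
  show ?thesis
    unfolding convex_on_has_right_deriv(2)[OF assms(1,2) x]
    using assms by (intro cINF_lower convex_on_has_right_deriv(3)[OF assms(1,2) x]) auto
qed

text \<open>A chord ending at \<open>y\<close> is no steeper than any chord starting there, hence
  its slope is at most the infimum of the latter slopes.\<close>

lemma convex_on_slope_le_right_deriv:
  fixes g :: "real \<Rightarrow> real"
  assumes "convex_on {l<..<r} g" "l < x" "x < y" "y < r"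
  shows "(g y - g x) / (y - x) \<le> right_deriv g y"
proof -
  have "(g y - g x) / (y - x) \<le> (g z - g y) / (z - y)" if "z \<in> {y<..<r}" for z
    using convex_on_slopes[OF assms(1), of x z y] assms that by auto
  then show ?thesis
    using assms convex_on_has_right_deriv(2)[OF assms(1), of y]
    by (auto intro!: cINF_greatest)
qed

lemma convex_on_right_deriv_mono:
  fixes g :: "real \<Rightarrow> real"
  assumes "convex_on {l<..<r} g"
  shows "mono_on {l<..<r} (right_deriv g)"
proof (rule mono_onI)
  fix x y assume "x \<in> {l<..<r}" "y \<in> {l<..<r}" "x \<le> y"
  then show "right_deriv g x \<le> right_deriv g y"
    using convex_on_right_deriv_le_slope[OF assms, of x y]
      convex_on_slope_le_right_deriv[OF assms, of x y]
    by (cases "x = y") auto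
qed

text \<open>The lower estimate is monotonicity. For the upper one, choose a chord from
  \<open>x\<close> to \<open>z\<close> of slope below \<open>c\<close>: its slope varies
  continuously with the left endpoint \<open>y\<close> and dominates the right derivative at
  \<open>y\<close>.\<close>

lemma convex_on_right_deriv_continuous_at_right:
  fixes g :: "real \<Rightarrow> real"
  assumes g: "convex_on {l<..<r} g" and x: "l < x" "x < r"
  shows "continuous (at_right x) (right_deriv g)"
  unfolding continuous_within
proof (rule order_tendstoI)
  fix c assume c: "c < right_deriv g x"
  have "c < right_deriv g y" if "x < y" "y < r" for y
    using c mono_onD[OF convex_on_right_deriv_mono[OF g], of x y] that x by auto
  then show "\<forall>\<^sub>F y in at_right x. c < right_deriv g y"
    using x by (auto simp: eventually_at_right[of x r])
next
  fix c assume c: "right_deriv g x < c"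
  have ne: "{x<..<r} \<noteq> {}"
    using x by simp
  have "\<exists>z\<in>{x<..<r}. (g z - g x) / (z - x) < c"
    using c unfolding convex_on_has_right_deriv(2)[OF g x]
      cINF_less_iff[OF ne convex_on_has_right_deriv(3)[OF g x]] .
  then obtain z where z: "x < z" "z < r" "(g z - g x) / (z - x) < c"
    by auto
  have "isCont g x"
    using convex_on_continuous[OF _ g] x by (simp add: continuous_on_eq_continuous_at)
  then have "((\<lambda>y. (g z - g y) / (z - y)) \<longlongrightarrow> (g z - g x) / (z - x)) (at_right x)"
    using z by (intro tendsto_intros filterlim_at_split[THEN iffD1, THEN conjunct2])
      (auto simp: isCont_def intro: tendsto_within_subset)
  then have "\<forall>\<^sub>F y in at_right x. (g z - g y) / (z - y) < c"
    using z by (intro order_tendstoD)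
  moreover have "\<forall>\<^sub>F y in at_right x. x < y \<and> y < z"
    using z by (auto simp: eventually_at_right[of x z])
  ultimately show "\<forall>\<^sub>F y in at_right x. right_deriv g y < c"
  proof eventually_elim
    case (elim y)
    then show ?case
      using convex_on_right_deriv_le_slope[OF g, of y z] x z by simp
  qed
qed

text \<open>Convexity ensures that the right derivative exists, so that
  \<open>vector_derivative\<close> is a genuine derivative and not an arbitrary choice.\<close>

lemma convex_on_right_deriv_uminus:
  fixes g :: "real \<Rightarrow> real"
  assumes "convex_on {l<..<r} g" "l < x" "x < r"
  shows "right_deriv (\<lambda>y. - g y) x = - right_deriv g x"
  unfolding right_deriv_def[of "\<lambda>y. - g y"]
  using has_vector_derivative_minus[OF convex_on_has_right_deriv(1)[OF assms]]
  by (intro vector_derivative_within) simp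

section \<open>Locally finite signed measures on an interval\<close>

lemma rel_compact_borel_subset_Ioc:
  assumes "B \<in> rel_compact_borel {l<..<r}" "l < r"
  obtains c d where "l < c" "c < d" "d < r" "B \<subseteq> {c<..d}"
proof -
  obtain K where K: "compact K" "K \<subseteq> {l<..<r}" "B \<subseteq> K"
    using assms unfolding rel_compact_borel_def by blast
  \<comment> \<open>Adding the midpoint to \<open>K\<close> covers the case of empty
    \<open>K\<close> and gives \<open>c < p \<le> m \<le> d\<close>, hence
    \<open>c < d\<close>.\<close>
  define m where "m = (l + r) / 2"
  have m: "l < m" "m < r"
    using assms(2) by (auto simp: m_def field_simps)
  have K': "compact (insert m K)" "insert m K \<noteq> {}"
    using K by auto
  obtain p where p: "p \<in> insert m K" "\<And>x. x \<in> insert m K \<Longrightarrow> p \<le> x"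
    using compact_attains_inf[OF K'] by blast
  obtain d where d: "d \<in> insert m K" "\<And>x. x \<in> insert m K \<Longrightarrow> x \<le> d"
    using compact_attains_sup[OF K'] by blast
  have "l < p"
    using p K m by auto
  then obtain c where "l < c" "c < p"
    using dense by blast
  moreover have "p \<le> m" "m \<le> d" "d < r"
    using p(2) d K m by auto
  moreover have "B \<subseteq> {c<..d}"
  proof
    fix x assume "x \<in> B"
    then have "p \<le> x" "x \<le> d"
      using p(2) d(2) K by auto
    then show "x \<in> {c<..d}"
      using \<open>c < p\<close> by simp
  qed
  ultimately show thesis
    using that[of c d] by linarith
qed

lemma Ioc_in_rel_compact_borel:
  assumes "l < c" "d < r"
  shows "{c<..d} \<in> rel_compact_borel {l<..<r}"
  unfolding rel_compact_borel_def using assms by (auto intro!: exI[of _ "{c..d}"])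

text \<open>Countable additivity is applied to the sequence \<open>A\<close>, \<open>B\<close>,
  \<open>{}\<close>, \<open>{}\<close>, and so on.\<close>

lemma locally_finite_signed_measure_Un:
  assumes \<mu>: "locally_finite_signed_measure S \<mu>"
    and "A \<in> rel_compact_borel S" "B \<in> rel_compact_borel S" "A \<union> B \<in> rel_compact_borel S"
    and "A \<inter> B = {}"
  shows "\<mu> (A \<union> B) = \<mu> A + \<mu> B"
proof -
  have "range (binaryset A B) \<subseteq> rel_compact_borel S" "(\<Union>i. binaryset A B i) \<in> rel_compact_borel S"
    using assms empty_in_rel_compact_borel[of S] by (auto simp: range_binaryset_eq)
  moreover have "disjoint_family (binaryset A B)"
    using assms by (auto simp: disjoint_family_on_def binaryset_def)
  ultimately have "(\<lambda>i. \<mu> (binaryset A B i)) sums \<mu> (A \<union> B)"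
    using \<mu> unfolding locally_finite_signed_measure_def by (metis UN_binaryset_eq)
  then show ?thesis
    using binaryset_sums[of \<mu> A B] locally_finite_signed_measure_empty[OF \<mu>] sums_unique2 by blast
qed

text \<open>Dynkin's argument, run inside a window \<open>{c<..d}\<close> that contains
  \<open>B\<close>: traces on the window always lie in the domain of both measures, and half-open
  intervals form an intersection-stable generator of the Borel sets.\<close>

lemma locally_finite_signed_measure_unique:
  assumes \<mu>: "locally_finite_signed_measure {l<..<r} \<mu>"
    and \<nu>: "locally_finite_signed_measure {l<..<r} \<nu>"
    and "l < r"
    and eq: "\<And>x y. l < x \<Longrightarrow> x < y \<Longrightarrow> y < r \<Longrightarrow> \<mu> {x<..y} = \<nu> {x<..y}"
  shows "\<mu> = \<nu>"
proof
  fix B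
  let ?R = "rel_compact_borel {l<..<r}"
  show "\<mu> B = \<nu> B"
  proof (cases "B \<in> ?R")
    case False
    then show ?thesis
      using \<mu> \<nu> unfolding locally_finite_signed_measure_def by simp
  next
    case True
    then obtain c d where cd: "l < c" "c < d" "d < r" "B \<subseteq> {c<..d}"
      using rel_compact_borel_subset_Ioc \<open>l < r\<close> by blast
    have J: "{c<..d} \<in> ?R"
      using cd by (intro Ioc_in_rel_compact_borel)
    \<comment> \<open>The trace of a generator on the window is again a half-open interval or
      empty.\<close>
    have eq': "\<mu> ({c<..d} \<inter> {x<..y}) = \<nu> ({c<..d} \<inter> {x<..y})" for x y
    proof (cases "max c x < min d y")
      case True
      then show ?thesis
        using cd eq[of "max c x" "min d y"] by (simp add: Int_greaterThanAtMost)
    next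
      case False
      then have "{c<..d} \<inter> {x<..y} = {}" by auto
      then show ?thesis
        using locally_finite_signed_measure_empty[OF \<mu>] locally_finite_signed_measure_empty[OF \<nu>]
        by (simp only:)
    qed
    let ?G = "range (\<lambda>(x, y). {x<..y::real})"
    have G: "Int_stable ?G" "?G \<subseteq> Pow UNIV"
      by (auto simp: Int_stable_def Int_greaterThanAtMost)
    have sets: "sigma_sets UNIV ?G = sets borel"
      unfolding borel_sigma_sets_Ioc by simp
    have "B \<in> sigma_sets UNIV ?G"
      using True unfolding sets rel_compact_borel_def by simp
    with G have "\<mu> ({c<..d} \<inter> B) = \<nu> ({c<..d} \<inter> B)"
    proof (induction B rule: sigma_sets_induct_disjoint)
      case (basic A)
      then show ?case using eq' by auto
    next
      case empty
      then show ?case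
        using locally_finite_signed_measure_empty[OF \<mu>] locally_finite_signed_measure_empty[OF \<nu>]
        by simp
    next
      case (compl A)
      have A: "A \<in> sets borel"
        using compl(1) unfolding sets .
      have R: "{c<..d} \<inter> A \<in> ?R" "{c<..d} \<inter> (UNIV - A) \<in> ?R"
        using A by (auto intro!: rel_compact_borel_Int[OF J])
      have split: "({c<..d} \<inter> A) \<union> ({c<..d} \<inter> (UNIV - A)) = {c<..d}"
        and disj: "({c<..d} \<inter> A) \<inter> ({c<..d} \<inter> (UNIV - A)) = {}"
        by auto
      \<comment> \<open>The complement is taken within the window, whose mass is a real number and
        may be subtracted.\<close>
      have "\<rho> {c<..d} = \<rho> ({c<..d} \<inter> A) + \<rho> ({c<..d} \<inter> (UNIV - A))"
        if "locally_finite_signed_measure {l<..<r} \<rho>" for \<rho>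
        using locally_finite_signed_measure_Un[OF that R _ disj] J unfolding split by simp
      from this[OF \<mu>] this[OF \<nu>] show ?case
        using compl(2) eq[of c d] cd by simp
    next
      case (union A)
      have R: "range (\<lambda>i. {c<..d} \<inter> A i) \<subseteq> ?R" "(\<Union>i. {c<..d} \<inter> A i) \<in> ?R"
      proof -
        have "range A \<subseteq> sets borel"
          using union(2) unfolding sets .
        then show "range (\<lambda>i. {c<..d} \<inter> A i) \<subseteq> ?R"
          by (auto intro!: rel_compact_borel_Int[OF J])
        from \<open>range A \<subseteq> sets borel\<close> have "(\<Union>i. A i) \<in> sets borel"
          by blast
        then show "(\<Union>i. {c<..d} \<inter> A i) \<in> ?R"
          unfolding Int_UN_distrib[symmetric] by (rule rel_compact_borel_Int[OF J])
      qed
      have disj: "disjoint_family (\<lambda>i. {c<..d} \<inter> A i)"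
        using union(1) unfolding disjoint_family_on_def by blast
      have "(\<lambda>i. \<rho> ({c<..d} \<inter> A i)) sums \<rho> (\<Union>i. {c<..d} \<inter> A i)"
        if "locally_finite_signed_measure {l<..<r} \<rho>" for \<rho>
        using that R disj unfolding locally_finite_signed_measure_def by blast
      from this[OF \<mu>] this[OF \<nu>] show ?case
        using union(3) sums_unique2 unfolding Int_UN_distrib[symmetric] by auto
    qed
    then show ?thesis
      using cd by (simp add: Int_absorb1)
  qed
qed

section \<open>Sign reversal, and the variation of a nonnegative measure\<close>

lemma locally_finite_signed_measure_uminus:
  assumes "locally_finite_signed_measure S \<mu>"
  shows "locally_finite_signed_measure S (\<lambda>B. - \<mu> B)"
  using assms unfolding locally_finite_signed_measure_def by (auto intro: sums_minus)

lemma variation_uminus: "variation S (\<lambda>B. - \<mu> B) = variation S \<mu>"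
  unfolding variation_def by simp

lemma variation_measure_uminus:
  "variation_measure S (\<lambda>B. - \<mu> B) = variation_measure S \<mu>"
  unfolding variation_measure_def variation_uminus ..

text \<open>By countable additivity every admissible partition gives the same sum, so the supremum
  is over a constant; the partition \<open>B\<close>, \<open>{}\<close>, \<open>{}\<close>, ...
  shows that the index set is nonempty.\<close>

lemma variation_nonneg_eq:
  assumes \<mu>: "locally_finite_signed_measure S \<mu>" and pos: "\<And>B. 0 \<le> \<mu> B"
    and B: "B \<in> rel_compact_borel S"
  shows "variation S \<mu> B = ennreal (\<mu> B)"
proof -
  have eq: "(\<Sum>i. ennreal \<bar>\<mu> (C i)\<bar>) = ennreal (\<mu> B)"
    if "disjoint_family C" "range C \<subseteq> rel_compact_borel S" "(\<Union>i. C i) = B" for C :: "nat \<Rightarrow> real set"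
  proof -
    have "(\<lambda>i. \<mu> (C i)) sums \<mu> B"
      using \<mu> that B unfolding locally_finite_signed_measure_def by metis
    then show ?thesis
      using pos by (simp add: sums_unique[symmetric])
  qed
  have trivial: "disjoint_family (binaryset B {})" "range (binaryset B {}) \<subseteq> rel_compact_borel S"
    "(\<Union>i. binaryset B {} i) = B"
    using B empty_in_rel_compact_borel[of S]
    by (auto simp: disjoint_family_on_def binaryset_def UN_binaryset_eq)
  have ne: "{C :: nat \<Rightarrow> real set. disjoint_family C \<and> range C \<subseteq> rel_compact_borel S \<and> (\<Union>i. C i) = B} \<noteq> {}"
    unfolding ex_in_conv[symmetric] by (intro exI[of _ "binaryset B {}"]) (simp add: trivial)
  show ?thesis
    unfolding variation_def using eq by (intro SUP_eq_const[OF ne]) blast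
qed

text \<open>
  \<^const>\<open>interval_measure\<close> needs a distribution function on the whole line; \<open>F\<close> may be unbounded
  near \<open>l\<close> and \<open>r\<close>, so it is pulled back along a homeomorphism between the line and \<open>(l, r)\<close>.
\<close>

lemma exists_locally_finite_signed_measure:
  fixes F :: "real \<Rightarrow> real"
  assumes "l < r" and mono: "mono_on {l<..<r} F"
    and cont: "\<And>x. l < x \<Longrightarrow> x < r \<Longrightarrow> continuous (at_right x) F"
  obtains \<mu> where "locally_finite_signed_measure {l<..<r} \<mu>" "\<And>B. 0 \<le> \<mu> B"
    "\<And>x y. l < x \<Longrightarrow> x < y \<Longrightarrow> y < r \<Longrightarrow> \<mu> {x<..y} = F y - F x"
proof -
  let ?R = "rel_compact_borel {l<..<r}"
  \<comment> \<open>\<open>\<phi>\<close> maps the line increasingly onto the interval, and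
    \<open>\<psi>\<close> is its inverse.\<close>
  define \<phi> where "\<phi> t = l + (r - l) * (arctan t / pi + 1 / 2)" for t
  define \<psi> where "\<psi> x = tan (pi * ((x - l) / (r - l) - 1 / 2))" for x
  have \<phi>_range: "l < \<phi> t" "\<phi> t < r" for t
  proof -
    have "0 < arctan t / pi + 1 / 2" "arctan t / pi + 1 / 2 < 1"
      using arctan_bounded[of t] by (auto simp: field_simps)
    then have "0 < (r - l) * (arctan t / pi + 1 / 2)" "(r - l) * (arctan t / pi + 1 / 2) < (r - l) * 1"
      using \<open>l < r\<close> by (auto intro!: mult_pos_pos mult_strict_left_mono simp del: mult_1_right)
    then show "l < \<phi> t" "\<phi> t < r"
      by (auto simp: \<phi>_def)
  qed
  have \<phi>_less: "\<phi> s < \<phi> t \<longleftrightarrow> s < t" for s t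
    using \<open>l < r\<close> by (simp add: \<phi>_def divide_less_cancel arctan_less_iff)
  have \<phi>_le: "\<phi> s \<le> \<phi> t \<longleftrightarrow> s \<le> t" for s t
    using \<phi>_less[of t s] by (auto simp: not_less[symmetric])
  have \<phi>\<psi>: "\<phi> (\<psi> x) = x" if "l < x" "x < r" for x
  proof -
    define v where "v = (x - l) / (r - l)"
    have v: "0 < v" "v < 1"
      using that by (auto simp: v_def)
    have "pi * v < pi * 1"
      using v by (intro mult_strict_left_mono) auto
    then have "arctan (tan (pi * (v - 1 / 2))) = pi * (v - 1 / 2)"
      using v by (intro arctan_tan) (auto simp: algebra_simps)
    then have "\<phi> (\<psi> x) = l + (r - l) * v"
      unfolding \<phi>_def \<psi>_def v_def[symmetric] by simp
    then show ?thesis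
      using \<open>l < r\<close> by (simp add: v_def)
  qed
  have \<phi>_cont: "isCont \<phi> t" for t
    unfolding \<phi>_def by (intro continuous_intros) auto
  have \<phi>_meas[measurable]: "\<phi> \<in> borel_measurable borel"
    using \<phi>_cont by (intro borel_measurable_continuous_onI) (simp add: continuous_on_eq_continuous_at)
  define H where "H t = F (\<phi> t)" for t
  have H_mono: "H s \<le> H t" if "s \<le> t" for s t
    unfolding H_def using that \<phi>_range \<phi>_le by (intro mono_onD[OF mono]) auto
  have H_cont: "continuous (at_right t) H" for t
  proof -
    \<comment> \<open>Strict monotonicity makes \<open>\<phi>\<close> approach its limit from above
      only, so right-continuity of \<open>F\<close> suffices.\<close>
    have "filterlim \<phi> (at_right (\<phi> t)) (at_right t)"
    proof (rule tendsto_imp_filterlim_at_right)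
      show "(\<phi> \<longlongrightarrow> \<phi> t) (at_right t)"
        using \<phi>_cont[of t] by (auto simp: isCont_def intro: tendsto_within_subset)
      show "\<forall>\<^sub>F s in at_right t. \<phi> t < \<phi> s"
        using eventually_at_right_less[of t] by (simp add: \<phi>_less)
    qed
    then show ?thesis
      using cont[OF \<phi>_range, of t] unfolding continuous_within H_def
      by (rule filterlim_compose[rotated])
  qed
  define N where "N = distr (interval_measure H) borel \<phi>"
  have sets_N[simp]: "sets N = sets borel"
    by (simp add: N_def)
  have N_Ioc: "emeasure N {x<..y} = ennreal (F y - F x)" if "l < x" "x < y" "y < r" for x y
  proof -
    have "\<phi> -` {x<..y} = {\<psi> x<..\<psi> y}"
      using \<phi>_less[of "\<psi> x"] \<phi>_le[of _ "\<psi> y"] that by (auto simp: \<phi>\<psi>)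
    moreover have "\<psi> x \<le> \<psi> y"
      using that \<phi>_le[of "\<psi> x" "\<psi> y"] by (simp add: \<phi>\<psi>)
    ultimately show ?thesis
      using that emeasure_interval_measure_Ioc[of "\<psi> x" "\<psi> y" H, OF _ H_mono H_cont]
      by (simp add: N_def emeasure_distr H_def \<phi>\<psi>)
  qed
  have N_fin: "emeasure N B \<noteq> \<infinity>" if B: "B \<in> ?R" for B
  proof -
    obtain c d where cd: "l < c" "c < d" "d < r" "B \<subseteq> {c<..d}"
      using rel_compact_borel_subset_Ioc[OF B \<open>l < r\<close>] .
    then have "emeasure N B \<le> ennreal (F d - F c)"
      using N_Ioc[OF cd(1-3)] emeasure_mono[of B "{c<..d}" N] by simp
    then show ?thesis
      using neq_top_trans[OF ennreal_neq_top] by auto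
  qed
  \<comment> \<open>\<open>N\<close> can have infinite total mass, but by \<open>N_fin\<close> it is
    finite on \<open>?R\<close>, where \<open>measure\<close> therefore loses nothing. The value 0
    elsewhere is the convention that makes uniqueness hold.\<close>
  define \<mu> where "\<mu> B = (if B \<in> ?R then measure N B else 0)" for B
  have "locally_finite_signed_measure {l<..<r} \<mu>"
    unfolding locally_finite_signed_measure_def
  proof (intro conjI allI impI)
    fix A :: "nat \<Rightarrow> real set"
    assume A: "range A \<subseteq> ?R" "disjoint_family A" "(\<Union>i. A i) \<in> ?R"
    have "range A \<subseteq> sets N"
      using A(1) by (auto simp: rel_compact_borel_def)
    then have "(\<lambda>i. measure N (A i)) sums measure N (\<Union>i. A i)"
      using A N_fin by (intro measure_UNION) auto
    then show "(\<lambda>i. \<mu> (A i)) sums \<mu> (\<Union>i. A i)"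
      using A by (simp add: \<mu>_def image_subset_iff)
  qed (simp add: \<mu>_def)
  moreover have "0 \<le> \<mu> B" for B
    by (simp add: \<mu>_def)
  moreover have "\<mu> {x<..y} = F y - F x" if "l < x" "x < y" "y < r" for x y
    using that N_Ioc[OF that] Ioc_in_rel_compact_borel[of l x y r] mono_onD[OF mono, of x y]
    by (simp add: \<mu>_def measure_def)
  ultimately show thesis
    by (rule that)
qed

section \<open>The second derivative measure\<close>

lemma second_deriv_measure_eqI:
  assumes "0 < a" "is_second_deriv_measure a g \<mu>"
  shows "second_deriv_measure a g = \<mu>"
  unfolding second_deriv_measure_def
proof (rule the_equality[of "is_second_deriv_measure a g", OF assms(2)])
  fix \<nu> assume "is_second_deriv_measure a g \<nu>"
  then show "\<nu> = \<mu>"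
    using assms unfolding is_second_deriv_measure_def
    by (intro locally_finite_signed_measure_unique[of 0 a]) auto
qed

lemma convex_on_second_deriv_measure:
  assumes "0 < a" and g: "convex_on {0<..<a} g"
  shows "is_second_deriv_measure a g (second_deriv_measure a g)"
    and "0 \<le> second_deriv_measure a g B"
proof -
  obtain \<mu> where \<mu>: "locally_finite_signed_measure {0<..<a} \<mu>" "\<And>B. 0 \<le> \<mu> B"
    "\<And>x y. 0 < x \<Longrightarrow> x < y \<Longrightarrow> y < a \<Longrightarrow> \<mu> {x<..y} = right_deriv g y - right_deriv g x"
    using exists_locally_finite_signed_measure[OF \<open>0 < a\<close> convex_on_right_deriv_mono[OF g]
      convex_on_right_deriv_continuous_at_right[OF g]] by blast
  then have "is_second_deriv_measure a g \<mu>"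
    unfolding is_second_deriv_measure_def by blast
  then show "is_second_deriv_measure a g (second_deriv_measure a g)"
    and "0 \<le> second_deriv_measure a g B"
    using second_deriv_measure_eqI[OF \<open>0 < a\<close>] \<mu>(2) by simp_all
qed

text \<open>This reduces concave functions to convex ones; the variation does not see the
  sign.\<close>

lemma second_deriv_measure_uminus:
  assumes "0 < a" and g: "convex_on {0<..<a} g"
  shows "second_deriv_measure a (\<lambda>x. - g x) = (\<lambda>B. - second_deriv_measure a g B)"
proof (rule second_deriv_measure_eqI[OF \<open>0 < a\<close>])
  show "is_second_deriv_measure a (\<lambda>x. - g x) (\<lambda>B. - second_deriv_measure a g B)"
    using convex_on_second_deriv_measure(1)[OF assms] convex_on_right_deriv_uminus[OF g]
    unfolding is_second_deriv_measure_def by (auto intro: locally_finite_signed_measure_uminus)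
qed

lemma convex_on_emeasure_variation_Ioc:
  assumes "0 < a" and g: "convex_on {0<..<a} g" and "0 < x" "x < y" "y < a"
  shows "emeasure (variation_measure {0<..<a} (second_deriv_measure a g)) {x<..y} =
    ennreal (right_deriv g y - right_deriv g x)"
proof -
  let ?\<mu> = "second_deriv_measure a g"
  have \<mu>: "locally_finite_signed_measure {0<..<a} ?\<mu>"
    "?\<mu> {x<..y} = right_deriv g y - right_deriv g x"
    using convex_on_second_deriv_measure(1)[OF assms(1,2)] assms
    unfolding is_second_deriv_measure_def by auto
  show ?thesis
    using assms emeasure_variation_measure[OF open_greaterThanLessThan \<mu>(1), of "{x<..y}"]
      variation_nonneg_eq[OF \<mu>(1) convex_on_second_deriv_measure(2)[OF assms(1,2)]
        Ioc_in_rel_compact_borel[of 0 x y a]] \<mu>(2)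
    by force
qed

section \<open>The bound near zero\<close>

lemma dyadic_bounds:
  fixes u :: real
  assumes "0 < u"
  shows "0 < u / 2 ^ n" "u / 2 ^ n \<le> u" "u / 2 ^ Suc n < u / 2 ^ n"
proof -
  show "0 < u / 2 ^ n"
    using assms by simp
  then show "u / 2 ^ Suc n < u / 2 ^ n"
    by simp
  show "u / 2 ^ n \<le> u"
    using assms divide_left_mono[of 1 "2 ^ n" u] by simp
qed

text \<open>Abel summation: for positive \<open>n\<close> the coefficient of \<open>F n\<close> is
  \<open>X n - X (n - 1) = - X n\<close>. The factor 2 at index 0 compensates for the term
  \<open>n = 0\<close> of the last sum.\<close>

lemma dyadic_sum_by_parts:
  fixes F X :: "nat \<Rightarrow> real"
  assumes "\<And>n. X n = 2 * X (Suc n)"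
  shows "(\<Sum>n<m. X n * (F n - F (Suc n))) = 2 * (X 0 * F 0) - 2 * (X m * F m) - (\<Sum>n<m. X n * F n)"
proof (induction m)
  case (Suc m)
  then show ?case
    using assms[of m] by (simp add: algebra_simps)
qed simp

lemma convex_on_dyadic_sum_bounded:
  fixes g :: "real \<Rightarrow> real"
  assumes g: "convex_on {0<..<a} g" and u: "0 < u" "u < a" and lim: "(g \<longlongrightarrow> L) (at_right 0)"
  defines "X \<equiv> \<lambda>n. u / 2 ^ n"
  obtains C where "\<And>m. (\<Sum>n<m. X n * (right_deriv g (X n) - right_deriv g (X (Suc n)))) \<le> C"
proof -
  let ?F = "right_deriv g"
  have X: "0 < X n" "X n < a" "X (Suc n) < X n" "X n = 2 * X (Suc n)" for n
    using dyadic_bounds[OF u(1), of n] u(2) by (auto simp: X_def)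
  have "filterlim X (at_right 0) sequentially"
  proof (rule tendsto_imp_filterlim_at_right)
    have "(\<lambda>n. u * (1 / 2) ^ n) \<longlonglongrightarrow> u * 0"
      by (intro tendsto_intros LIMSEQ_power_zero) simp
    then show "X \<longlonglongrightarrow> 0"
      by (simp add: X_def power_one_over)
  qed (use X(1) in auto)
  then have "(\<lambda>n. g (X n)) \<longlonglongrightarrow> L"
    by (rule filterlim_compose[OF lim])
  then obtain K where "\<bar>g (X n)\<bar> \<le> K" for n
    using convergent_imp_Bseq convergentI Bseq_def by (metis real_norm_def)
  then have K: "g (X n) \<le> K" "- K \<le> g (X n)" for n
    by (simp_all add: abs_le_iff minus_le_iff)
  \<comment> \<open>The chord from \<open>X (Suc n)\<close> to \<open>X n\<close> has length
    \<open>X (Suc n)\<close>, half of \<open>X n\<close>; this is the factor 2.\<close>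
  have slope: "- (X n * ?F (X n)) \<le> 2 * (g (X (Suc n)) - g (X n))" for n
  proof -
    have "(g (X n) - g (X (Suc n))) / X (Suc n) \<le> ?F (X n)"
      using convex_on_slope_le_right_deriv[OF g, of "X (Suc n)" "X n"] X(1-3)[of n] X(1)[of "Suc n"]
        X(4)[of n] by simp
    then show ?thesis
      using X(1)[of "Suc n"] X(4)[of n] by (simp add: field_simps)
  qed
  have tele: "- (\<Sum>n<m. X n * ?F (X n)) \<le> 2 * (g (X m) - g (X 0))" for m
  proof (induction m)
    case (Suc m)
    then show ?case using slope[of m] by simp
  qed simp
  \<comment> \<open>By \<open>slope\<close> and \<open>tele\<close>, the last two terms of the
    summation by parts contribute at most
    \<open>4 * g (X (Suc m)) - 2 * g (X m) - 2 * g (X 0)\<close>, whence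
    \<open>8 * K\<close>.\<close>
  have "(\<Sum>n<m. X n * (?F (X n) - ?F (X (Suc n)))) \<le> 2 * (X 0 * ?F (X 0)) + 8 * K" for m
    using dyadic_sum_by_parts[of X, OF X(4), of "\<lambda>n. ?F (X n)" m] slope[of m] tele[of m]
      K[of m] K[of "Suc m"] K[of 0]
    by argo
  then show thesis
    by (rule that)
qed

text \<open>The right end of the cell is the last dyadic point not below \<open>x\<close>. The least
  exponent \<open>k\<close> with \<open>u / 2 ^ k < x\<close> is nonzero because
  \<open>x \<le> u\<close>, so it has a predecessor.\<close>

lemma greaterThanAtMost_dyadic_cover:
  fixes x u :: real
  assumes "0 < x" "x \<le> u"
  shows "\<exists>n. x \<in> {u / 2 ^ Suc n<..u / 2 ^ n}"
proof -
  have "0 < x / u"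
    using assms by simp
  then obtain m where "(1 / 2) ^ m < x / u"
    using real_arch_pow_inv[of "x / u" "1 / 2"] by auto
  then have m: "u / 2 ^ m < x"
    using assms by (simp add: field_simps power_one_over)
  define k where "k = (LEAST m. u / 2 ^ m < x)"
  have k: "u / 2 ^ k < x"
    unfolding k_def by (rule LeastI[of "\<lambda>m. u / 2 ^ m < x", OF m])
  then obtain n where n: "k = Suc n"
    using assms by (cases k) auto
  then have "\<not> u / 2 ^ n < x"
    unfolding k_def by (intro not_less_Least) simp
  then show ?thesis
    using k n by (auto intro!: exI[of _ n])
qed

text \<open>On each dyadic cell the integrand is at most the right endpoint, and the mass of the
  cell is an increment of the right derivative. Termwise integration leaves a series with bounded
  partial sums.\<close>

lemma convex_on_nn_integral_second_deriv_measure: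
  fixes g :: "real \<Rightarrow> real"
  assumes "0 < a" and g: "convex_on {0<..<a} g" and lim: "(g \<longlongrightarrow> L) (at_right 0)"
    and u: "0 < u" "u < a"
  shows "(\<integral>\<^sup>+ x \<in> {0<..u}. ennreal x
            \<partial>variation_measure {0<..<a} (second_deriv_measure a g)) < \<infinity>"
proof -
  let ?F = "right_deriv g" and ?V = "variation_measure {0<..<a} (second_deriv_measure a g)"
  define X where "X n = u / 2 ^ n" for n
  have X: "0 < X n" "X n < a" "X (Suc n) < X n" for n
    using dyadic_bounds[OF u(1), of n] u(2) by (auto simp: X_def)
  obtain C where C: "(\<Sum>n<m. X n * (?F (X n) - ?F (X (Suc n)))) \<le> C" for m
    using convex_on_dyadic_sum_bounded[OF g u lim] unfolding X_def by blast
  define I where "I n = {X (Suc n)<..X n}" for n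
  have I: "I n \<in> sets ?V" for n
    using X[of n] X[of "Suc n"] unfolding I_def by (auto simp: sets_variation_measure)
  have le_suminf: "f n \<le> suminf f" for f :: "nat \<Rightarrow> ennreal" and n
    using sum_le_suminf[of f "{n}"] by simp
  \<comment> \<open>Nonnegativity lets \<open>ennreal\<close> commute with the finite sums, so that
    the real bound \<open>C\<close> transfers.\<close>
  have pos: "0 \<le> X n * (?F (X n) - ?F (X (Suc n)))" for n
    using X[of n] X[of "Suc n"] mono_onD[OF convex_on_right_deriv_mono[OF g], of "X (Suc n)" "X n"]
    by simp
  have "(\<integral>\<^sup>+ x \<in> {0<..u}. ennreal x \<partial>?V) \<le> (\<integral>\<^sup>+ x. (\<Sum>n. ennreal (X n) * indicator (I n) x) \<partial>?V)"
  proof (rule nn_integral_mono)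
    fix x
    show "ennreal x * indicator {0<..u} x \<le> (\<Sum>n. ennreal (X n) * indicator (I n) x)"
    proof (cases "x \<in> {0<..u}")
      case True
      then obtain n where n: "x \<in> I n"
        using greaterThanAtMost_dyadic_cover[of x u] unfolding I_def X_def by auto
      then have "ennreal x * indicator {0<..u} x \<le> ennreal (X n) * indicator (I n) x"
        using True by (auto simp: I_def intro: ennreal_leI)
      also have "\<dots> \<le> (\<Sum>n. ennreal (X n) * indicator (I n) x)"
        using le_suminf[of "\<lambda>n. ennreal (X n) * indicator (I n) x" n] .
      finally show ?thesis .
    qed simp
  qed
  also have "\<dots> = (\<Sum>n. \<integral>\<^sup>+ x. ennreal (X n) * indicator (I n) x \<partial>?V)"
    using I by (intro nn_integral_suminf) simp
  also have "\<dots> = (\<Sum>n. ennreal (X n * (?F (X n) - ?F (X (Suc n)))))"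
  proof (intro arg_cong[where f = suminf] ext)
    fix n
    have "(\<integral>\<^sup>+ x. ennreal (X n) * indicator (I n) x \<partial>?V) = ennreal (X n) * emeasure ?V (I n)"
      using I by (intro nn_integral_cmult_indicator)
    then show "(\<integral>\<^sup>+ x. ennreal (X n) * indicator (I n) x \<partial>?V) =
        ennreal (X n * (?F (X n) - ?F (X (Suc n))))"
      using convex_on_emeasure_variation_Ioc[OF \<open>0 < a\<close> g, of "X (Suc n)" "X n"] X[of n] X[of "Suc n"]
      by (simp add: I_def ennreal_mult')
  qed
  also have "\<dots> \<le> ennreal C"
    using pos C by (intro suminf_le_const summableI) (simp add: sum_ennreal ennreal_leI)
  finally show ?thesis
    using le_less_trans ennreal_less_top infinity_ennreal_def by metis
qed

theorem lemma5p2: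
  fixes a u :: real and g :: "real \<Rightarrow> real"
  assumes "a > 0"
    and "convex_on {0<..<a} g \<or> concave_on {0<..<a} g"
    and "\<exists>L. (g \<longlongrightarrow> L) (at_right 0)"
    and "u \<in> {0<..<a}"
  shows "(\<integral>\<^sup>+ x \<in> {0<..u}. ennreal x
            \<partial>variation_measure {0<..<a} (second_deriv_measure a g)) < \<infinity>"
proof -
  obtain L where L: "(g \<longlongrightarrow> L) (at_right 0)"
    using assms(3) by blast
  from assms(2) show ?thesis
  proof
    assume "convex_on {0<..<a} g"
    then show ?thesis
      using convex_on_nn_integral_second_deriv_measure L assms(1,4) by auto
  next
    assume "concave_on {0<..<a} g"
    then have h: "convex_on {0<..<a} (\<lambda>x. - g x)"
      by (simp add: concave_on_def)
    \<comment> \<open>The sign rule is applied to the convex function \<open>- g\<close>, whose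
      negative is \<open>g\<close>.\<close>
    have "second_deriv_measure a g = (\<lambda>B. - second_deriv_measure a (\<lambda>x. - g x) B)"
      using second_deriv_measure_uminus[OF assms(1) h] by simp
    then show ?thesis
      using convex_on_nn_integral_second_deriv_measure[OF assms(1) h tendsto_minus[OF L], of u] assms(4)
      by (simp add: variation_measure_uminus)
  qed
qed

end
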